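(* Let $A=\mathbb{Z}[\rho]$ with $\rho=e^{2\pi i/6}$, and let $f$ be a primitive, integral, positive definite binary hermitian form over $\mathbb{Q}(\sqrt{-3})$ of discriminant $\Delta$. Then there exists $\mathbf v\neq0$ in $A^2$ with $f(\mathbf v)\le\sqrt{-\Delta/2}$. Moreover, equality $\min_{\mathbf v\in A^2\setminus\{0\}}f(\mathbf v)=\sqrt{-\Delta/2}$ is achieved only for the unique $\mathrm{GL}_2(A)$-equivalence class of such forms of discriminant $-2$.
   Context: $N(x)=|x|^2$. A binary hermitian form over $\mathbb{Q}(\sqrt{-3})$ is $f(x,y)=aN(x)+cN(y)+\nu x\bar y+\bar\nu\bar xy$ with $a,c\in\mathbb{Q}$, $\nu\in\mathbb{Q}(\sqrt{-3})$; integral means $f(A^2)\subseteq\mathbb{Z}$; primitive means the values $f(\mathbf w)$, $\mathbf w\in A^2$, have greatest common divisor $1$. The discriminant is $\Delta=-3(ac-N(\nu))$ computed from the matrix $\begin{pmatrix}a&\nu\\ \bar\nu&c\end{pmatrix}$ of $f$ in a basis of $A^2$ (independent of that basis); $\Delta<0$ for definite forms. Two forms $f,f'$ are $\mathrm{GL}_2(A)$-equivalent if $f'(\mathbf w)=f(g\mathbf w)$ for some $g\in\mathrm{GL}_2(A)$ and all $\mathbf w$. *)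

theory Defs
  imports "HOL-Analysis.Analysis" "HOL-Computational_Algebra.Polynomial"
begin

definition rho :: complex where
  "rho = exp (2 * of_real pi * \<i> / 6)"

definition ringA :: "complex set" where
  "ringA = {of_int m + of_int n * rho | m n. True}"

definition fieldK :: "complex set" where
  "fieldK = {of_rat p + of_rat q * csqrt (-3) | p q. True}"

definition latticeA2 :: "(complex ^ 2) set" where
  "latticeA2 = {v. \<forall>i. v $ i \<in> ringA}"

definition spaceK2 :: "(complex ^ 2) set" where
  "spaceK2 = {v. \<forall>i. v $ i \<in> fieldK}"

definition nrm :: "complex \<Rightarrow> real" where
  "nrm z = (cmod z)\<^sup>2"

text \<open>A form is given by its coefficients; \<open>hermitian_form\<close> is the
  condition that they define a form over $\mathbb{Q}(\sqrt{-3})$.\<close>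

record hform =
  coef_a :: rat
  coef_c :: rat
  coef_nu :: complex

definition hermitian_form :: "hform \<Rightarrow> bool" where
  "hermitian_form f \<longleftrightarrow> coef_nu f \<in> fieldK"

text \<open>The cross terms are complex conjugates of each other, so taking the real part
  loses nothing; see \<open>of_real_hval\<close>.\<close>

definition hval :: "hform \<Rightarrow> complex ^ 2 \<Rightarrow> real" where
  "hval f v = of_rat (coef_a f) * nrm (v $ 1) + of_rat (coef_c f) * nrm (v $ 2)
     + Re (coef_nu f * v $ 1 * cnj (v $ 2) + cnj (coef_nu f) * cnj (v $ 1) * v $ 2)"

definition hmatrix :: "hform \<Rightarrow> complex ^ 2 ^ 2" where
  "hmatrix f = vector [vector [of_rat (coef_a f), coef_nu f],
                       vector [cnj (coef_nu f), of_rat (coef_c f)]]"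

definition disc :: "hform \<Rightarrow> real" where
  "disc f = - 3 * (of_rat (coef_a f) * of_rat (coef_c f) - nrm (coef_nu f))"

definition hform_integral :: "hform \<Rightarrow> bool" where
  "hform_integral f \<longleftrightarrow> (\<forall>w\<in>latticeA2. hval f w \<in> \<int>)"

definition hform_primitive :: "hform \<Rightarrow> bool" where
  "hform_primitive f \<longleftrightarrow> Gcd {n :: int. \<exists>w\<in>latticeA2. hval f w = of_int n} = 1"

definition hform_pos_def :: "hform \<Rightarrow> bool" where
  "hform_pos_def f \<longleftrightarrow> (\<forall>w\<in>spaceK2. w \<noteq> 0 \<longrightarrow> hval f w > 0)"

definition pip_form :: "hform \<Rightarrow> bool" where
  "pip_form f \<longleftrightarrow>
     hermitian_form f \<and> hform_integral f \<and> hform_primitive f \<and> hform_pos_def f"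

definition GL2A :: "(complex ^ 2 ^ 2) set" where
  "GL2A = {g. (\<forall>i j. g $ i $ j \<in> ringA) \<and>
              (\<exists>h. (\<forall>i j. h $ i $ j \<in> ringA) \<and> g ** h = mat 1 \<and> h ** g = mat 1)}"

definition GL2A_equiv :: "hform \<Rightarrow> hform \<Rightarrow> bool" where
  "GL2A_equiv f f' \<longleftrightarrow> (\<exists>g\<in>GL2A. \<forall>w\<in>latticeA2. hval f' w = hval f (g *v w))"

definition is_minimum :: "hform \<Rightarrow> real \<Rightarrow> bool" where
  "is_minimum f m \<longleftrightarrow>
     (\<exists>v\<in>latticeA2 - {0}. hval f v = m) \<and> (\<forall>v\<in>latticeA2 - {0}. m \<le> hval f v)"

lemma of_real_hval:
  "complex_of_real (hval f v) =
     of_rat (coef_a f) * of_real (nrm (v $ 1)) + of_rat (coef_c f) * of_real (nrm (v $ 2))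
     + coef_nu f * v $ 1 * cnj (v $ 2) + cnj (coef_nu f) * cnj (v $ 1) * v $ 2"
proof -
  have r: "complex_of_real (of_rat q) = of_rat q" for q
    by (cases q) (simp add: of_rat_rat)
  show ?thesis
    by (simp add: hval_def r[symmetric] complex_eq_iff algebra_simps)
qed

lemma disc_eq_det: "complex_of_real (disc f) = - 3 * det (hmatrix f)"
proof -
  have r: "complex_of_real (of_rat q) = of_rat q" for q
    by (cases q) (simp add: of_rat_rat)
  show ?thesis
    by (simp add: disc_def hmatrix_def det_2 nrm_def r[symmetric] complex_norm_square
        flip: of_real_power)
qed

lemma rho_eq: "rho = Complex (1/2) (sqrt 3 / 2)"
proof -
  have "rho = cis (pi / 3)"
    by (simp add: rho_def cis_conv_exp mult.commute)
  then show ?thesis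
    by (simp add: complex_eq_iff cos_60 sin_60)
qed

lemma rho_sq: "rho * rho = rho - 1"
  by (simp add: rho_eq complex_eq_iff)

lemma ringA_eq_poly: "ringA = range (\<lambda>p :: int poly. poly (map_poly of_int p) rho)"
proof (intro equalityI subsetI)
  fix z assume "z \<in> ringA"
  then obtain m n where "z = of_int m + of_int n * rho" by (auto simp: ringA_def)
  then have "z = poly (map_poly of_int [:m, n:]) rho"
    by (simp add: map_poly_pCons mult.commute)
  then show "z \<in> range (\<lambda>p :: int poly. poly (map_poly of_int p) rho)" by blast
next
  have "poly (map_poly of_int p) rho \<in> ringA" for p :: "int poly"
  proof (induction p)
    case 0
    have "poly (map_poly of_int (0 :: int poly)) rho = of_int 0 + of_int 0 * rho" by simp
    then show ?case unfolding ringA_def by blast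
  next
    case (pCons a p)
    then obtain m n where mn: "poly (map_poly of_int p) rho = of_int m + of_int n * rho"
      by (auto simp: ringA_def)
    have "poly (map_poly of_int (pCons a p)) rho
        = of_int a + rho * (of_int m + of_int n * rho)"
      using mn by (simp add: map_poly_pCons)
    also have "\<dots> = of_int a + of_int m * rho + of_int n * (rho * rho)"
      by (simp add: algebra_simps)
    also have "\<dots> = of_int (a - n) + of_int (m + n) * rho"
      by (simp add: rho_sq algebra_simps)
    finally show ?case unfolding ringA_def by blast
  qed
  then show "\<And>z. z \<in> range (\<lambda>p :: int poly. poly (map_poly of_int p) rho) \<Longrightarrow> z \<in> ringA"
    by blast
qed

end

theory Submission
  imports Defs
begin

text \<open>
  A minimal vector of \<open>f\<close> is primitive, hence (\<open>A\<close> being Euclidean) the first member of a basis of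
  \<open>A\<^sup>2\<close>. In that basis the matrix of \<open>f\<close> has entries \<open>m = min f\<close>, \<open>c \<ge> m\<close> and \<open>\<nu>\<close>, and a shear moves
  \<open>\<nu> / m\<close> into the hexagonal Voronoi cell of \<open>A\<close>, so that \<open>N(\<nu>) \<le> m\<^sup>2 / 3\<close> and
  \<open>- \<Delta> = 3 (m c - N(\<nu>)) \<ge> 2 m\<^sup>2\<close>. Equality forces \<open>c = m\<close> and \<open>\<nu> / m\<close> to be a vertex of the cell;
  modulo \<open>A\<close> these vertices are \<open>\<plusminus> (1 + \<rho>) / 3\<close>. Then \<open>f\<close> is \<open>m\<close> times an integral form, so
  primitivity gives \<open>m = 1\<close>, and the sign is absorbed by a unit.
\<close>

section \<open>The ring A of Eisenstein integers\<close>

lemma ringA_iff: "z \<in> ringA \<longleftrightarrow> (\<exists>m n. z = of_int m + of_int n * rho)"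
  by (auto simp: ringA_def)

lemma ringA_of_int [simp]: "of_int k \<in> ringA"
  unfolding ringA_iff by (rule exI[of _ k], rule exI[of _ 0]) simp

lemma ringA_0 [simp]: "0 \<in> ringA" and ringA_1 [simp]: "1 \<in> ringA"
  using ringA_of_int[of 0] ringA_of_int[of 1] by simp_all

lemma ringA_rho [simp]: "rho \<in> ringA"
  unfolding ringA_iff by (rule exI[of _ 0], rule exI[of _ 1]) simp

lemma ringA_add [simp]:
  assumes "x \<in> ringA" "y \<in> ringA" shows "x + y \<in> ringA"
proof -
  obtain m n m' n' where "x = of_int m + of_int n * rho" "y = of_int m' + of_int n' * rho"
    using assms ringA_iff by metis
  then have "x + y = of_int (m + m') + of_int (n + n') * rho"
    by (simp add: algebra_simps)
  then show ?thesis unfolding ringA_iff by blast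
qed

lemma ringA_mult [simp]:
  assumes "x \<in> ringA" "y \<in> ringA" shows "x * y \<in> ringA"
proof -
  obtain m n m' n' where mn: "x = of_int m + of_int n * rho" "y = of_int m' + of_int n' * rho"
    using assms ringA_iff by metis
  have "x * y = of_int (m * m') + of_int (m * n' + m' * n) * rho + of_int (n * n') * (rho * rho)"
    by (simp add: mn algebra_simps)
  also have "\<dots> = of_int (m * m' - n * n') + of_int (m * n' + m' * n + n * n') * rho"
    by (simp add: rho_sq algebra_simps)
  finally show ?thesis unfolding ringA_iff by blast
qed

lemma ringA_minus [simp]: "x \<in> ringA \<Longrightarrow> - x \<in> ringA"
  using ringA_mult[OF ringA_of_int[of "-1"]] by fastforce

lemma ringA_diff [simp]: "x \<in> ringA \<Longrightarrow> y \<in> ringA \<Longrightarrow> x - y \<in> ringA"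
  using ringA_add[of x "- y"] by simp

lemma cnj_rho: "cnj rho = 1 - rho"
  by (simp add: rho_eq complex_eq_iff)

lemma ringA_cnj [simp]:
  assumes "x \<in> ringA" shows "cnj x \<in> ringA"
proof -
  obtain m n where "x = of_int m + of_int n * rho" using assms ringA_iff by metis
  then have "cnj x = of_int m + of_int n * (1 - rho)" by (simp add: cnj_rho)
  then show ?thesis by simp
qed

section \<open>The norm on A\<close>

lemma nrm_eq: "nrm z = (Re z)\<^sup>2 + (Im z)\<^sup>2"
  by (simp add: nrm_def cmod_power2)

lemma nrm_mult: "nrm (x * y) = nrm x * nrm y"
  by (simp add: nrm_def norm_mult power_mult_distrib)

lemma nrm_1 [simp]: "nrm 1 = 1" and nrm_0 [simp]: "nrm 0 = 0"
  and nrm_minus [simp]: "nrm (- x) = nrm x" and nrm_cnj [simp]: "nrm (cnj x) = nrm x"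
  and nrm_nonneg [simp]: "nrm x \<ge> 0" and nrm_pos_iff [simp]: "nrm x > 0 \<longleftrightarrow> x \<noteq> 0"
  and nrm_of_real [simp]: "nrm (of_real r) = r\<^sup>2"
  by (simp_all add: nrm_def)

lemma of_real_nrm: "complex_of_real (nrm z) = z * cnj z"
  by (simp add: nrm_def complex_norm_square flip: of_real_power)

lemma nrm_lincomb_rho: "nrm (of_real a + of_real b * rho) = a\<^sup>2 + a * b + b\<^sup>2"
proof -
  have "(sqrt 3)\<^sup>2 = (3::real)" by simp
  then show ?thesis
    by (simp add: nrm_eq rho_eq power2_eq_square algebra_simps)
qed

lemma nrm_ringA:
  assumes "x \<in> ringA"
  obtains n :: nat where "nrm x = of_nat n"
proof -
  obtain m n where "x = of_int m + of_int n * rho" using assms ringA_iff by metis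
  then have "x = of_real (of_int m) + of_real (of_int n) * rho" by simp
  then have "nrm x = (of_int m)\<^sup>2 + of_int m * of_int n + (of_int n)\<^sup>2"
    using nrm_lincomb_rho[of "of_int m" "of_int n"] by simp
  then have *: "nrm x = of_int (m\<^sup>2 + m * n + n\<^sup>2)" by simp
  then have "m\<^sup>2 + m * n + n\<^sup>2 \<ge> 0" using nrm_nonneg[of x] by (metis of_int_0_le_iff)
  then have "nrm x = of_nat (nat (m\<^sup>2 + m * n + n\<^sup>2))" using * by simp
  then show ?thesis using that by blast
qed

lemma nrm_ringA_Ints: "x \<in> ringA \<Longrightarrow> nrm x \<in> \<int>"
  by (metis nrm_ringA Ints_of_nat)

text \<open>The norms of \<open>x\<close> and \<open>y\<close> are natural numbers with product
  1.\<close>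

lemma ringA_unit_nrm:
  assumes "x \<in> ringA" "y \<in> ringA" "x * y = 1"
  shows "nrm x = 1"
proof -
  obtain m n :: nat where mn: "nrm x = of_nat m" "nrm y = of_nat n"
    using nrm_ringA assms by metis
  have "real (m * n) = 1" using mn nrm_mult[of x y] assms by simp
  then have "m * n = 1" by (metis of_nat_1_eq_iff)
  then show ?thesis using mn by simp
qed

section \<open>Covering radius of the hexagonal lattice A\<close>

text \<open>Barycentre of the triangle \<open>0\<close>, \<open>1\<close>, \<open>rho\<close>: a
  deep hole of the lattice A, that is, a vertex of its hexagonal Voronoi cell.\<close>

definition kappa :: complex where "kappa = (1 + rho) / 3"

lemma nrm_kappa: "nrm kappa = 1 / 3"
proof -
  have k: "kappa = of_real (1/3) + of_real (1/3) * rho" by (simp add: kappa_def field_simps)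
  show ?thesis unfolding k nrm_lincomb_rho by (simp add: power2_eq_square)
qed

text \<open>The average of the squared distances to the vertices of a unit triangle, weighted by the
  barycentric coordinates \<open>w, a, b\<close>, is \<open>w a + w b + a b\<close>, which is at most \<open>1/3\<close>
  with equality only at the barycentre.\<close>

lemma triangle_covering:
  fixes a b :: real
  assumes "a \<ge> 0" "b \<ge> 0" "a + b \<le> 1"
  shows "a\<^sup>2 + a * b + b\<^sup>2 < 1/3 \<or> (a - 1)\<^sup>2 + (a - 1) * b + b\<^sup>2 < 1/3 \<or>
         a\<^sup>2 + a * (b - 1) + (b - 1)\<^sup>2 < 1/3 \<or> (a = 1/3 \<and> b = 1/3)"
proof (rule ccontr)
  assume "\<not> ?thesis"
  then have far: "a\<^sup>2 + a * b + b\<^sup>2 \<ge> 1/3" "(a - 1)\<^sup>2 + (a - 1) * b + b\<^sup>2 \<ge> 1/3"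
    "a\<^sup>2 + a * (b - 1) + (b - 1)\<^sup>2 \<ge> 1/3" and ne: "\<not> (a = 1/3 \<and> b = 1/3)" by auto
  define w where "w = 1 - a - b"
  have "w * (a\<^sup>2 + a * b + b\<^sup>2) + a * ((a - 1)\<^sup>2 + (a - 1) * b + b\<^sup>2)
      + b * (a\<^sup>2 + a * (b - 1) + (b - 1)\<^sup>2) \<ge> w * (1/3) + a * (1/3) + b * (1/3)"
    using assms far by (intro add_mono mult_left_mono) (auto simp: w_def)
  moreover have "w * (a\<^sup>2 + a * b + b\<^sup>2) + a * ((a - 1)\<^sup>2 + (a - 1) * b + b\<^sup>2)
      + b * (a\<^sup>2 + a * (b - 1) + (b - 1)\<^sup>2) = a + b - a\<^sup>2 - a * b - b\<^sup>2"
    unfolding w_def by algebra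
  moreover have "w * (1/3) + a * (1/3) + b * (1/3) = 1/3" by (simp add: w_def field_simps)
  ultimately have "a + b - a\<^sup>2 - a * b - b\<^sup>2 \<ge> 1/3" by linarith
  \<comment> \<open>Completing the square: both squares vanish only at the barycentre.\<close>
  moreover have "1/3 - (a + b - a\<^sup>2 - a * b - b\<^sup>2) = (a + b/2 - 1/2)\<^sup>2 + 3/4 * (b - 1/3)\<^sup>2"
    by (simp add: power2_eq_square field_simps)
  ultimately have "(a + b/2 - 1/2)\<^sup>2 + 3/4 * (b - 1/3)\<^sup>2 \<le> 0" by linarith
  then have "(a + b/2 - 1/2)\<^sup>2 = 0" "(b - 1/3)\<^sup>2 = 0"
    using zero_le_power2[of "a + b/2 - 1/2"] zero_le_power2[of "b - 1/3"] by linarith+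
  then show False using ne by (simp add: field_simps)
qed

text \<open>Here \<open>t\<close> is a vertex of the triangle \<open>0\<close>, \<open>1\<close>,
  \<open>rho\<close> containing \<open>z\<close>. Only the barycentre has no vertex within squared
  distance less than 1/3; there \<open>t = 0\<close> leaves \<open>kappa\<close>.\<close>

lemma nearest_ringA_triangle:
  fixes a b :: real
  assumes "a \<ge> 0" "b \<ge> 0" "a + b \<le> 1" and z: "z = of_real a + of_real b * rho"
  shows "\<exists>t\<in>ringA. nrm (z - t) < 1/3 \<or> z - t = kappa"
proof -
  have "z - 1 = of_real (a - 1) + of_real b * rho"
    and "z - rho = of_real a + of_real (b - 1) * rho"
    by (simp_all add: z algebra_simps)
  then have n: "nrm (z - 0) = a\<^sup>2 + a * b + b\<^sup>2" "nrm (z - 1) = (a - 1)\<^sup>2 + (a - 1) * b + b\<^sup>2"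
    "nrm (z - rho) = a\<^sup>2 + a * (b - 1) + (b - 1)\<^sup>2"
    using z by (simp_all only: nrm_lincomb_rho diff_zero)
  show ?thesis
  proof (cases "a = 1/3 \<and> b = 1/3")
    case True
    then have "a = 1/3" "b = 1/3" by auto
    with z have "z = of_real (1/3) + of_real (1/3) * rho" by (simp only:)
    then have "z - 0 = kappa" by (simp add: kappa_def field_simps)
    then show ?thesis using ringA_0 by blast
  next
    case False
    then show ?thesis
      using triangle_covering[OF assms(1-3)] n ringA_0 ringA_1 ringA_rho by metis
  qed
qed

text \<open>Modulo A, \<open>z\<close> lies in the parallelogram spanned by \<open>1\<close> and
  \<open>rho\<close>, which the diagonal from \<open>1\<close> to \<open>rho\<close> cuts into two
  triangles. A half turn swaps them, hence the second exceptional point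
  \<open>- kappa\<close>.\<close>

lemma nearest_ringA:
  "\<exists>t\<in>ringA. nrm (z - t) < 1/3 \<or> z - t = kappa \<or> z - t = - kappa"
proof -
  \<comment> \<open>\<open>a\<close> and \<open>b\<close> are the coordinates of \<open>z\<close> in
    the real basis \<open>1\<close>, \<open>rho\<close>.\<close>
  define b where "b = 2 * Im z / sqrt 3"
  define a where "a = Re z - b / 2"
  have z: "z = of_real a + of_real b * rho"
    by (simp add: complex_eq_iff rho_eq a_def b_def)
  define t0 where "t0 = of_int \<lfloor>a\<rfloor> + of_int \<lfloor>b\<rfloor> * rho"
  have t0: "t0 \<in> ringA" by (simp add: t0_def)
  have z': "z - t0 = of_real (frac a) + of_real (frac b) * rho"
    by (simp add: z t0_def frac_def algebra_simps)
  show ?thesis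
  proof (cases "frac a + frac b \<le> 1")
    case True
    then obtain t where "t \<in> ringA" "nrm (z - t0 - t) < 1/3 \<or> z - t0 - t = kappa"
      using nearest_ringA_triangle[OF _ _ _ z'] by auto
    then show ?thesis using t0 by (intro bexI[of _ "t0 + t"]) (auto simp: algebra_simps)
  next
    case False
    \<comment> \<open>The half turn sending \<open>w\<close> to \<open>1 + rho - w\<close>, applied
      to \<open>w = z - t0\<close>, moves the upper triangle onto the lower one.\<close>
    have "t0 + 1 + rho - z = of_real (1 - frac a) + of_real (1 - frac b) * rho"
      using z' by (simp add: algebra_simps)
    then obtain t where t: "t \<in> ringA"
      "nrm (t0 + 1 + rho - z - t) < 1/3 \<or> t0 + 1 + rho - z - t = kappa"
      using False nearest_ringA_triangle[of "1 - frac a" "1 - frac b" "t0 + 1 + rho - z"]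
        frac_lt_1[of a] frac_lt_1[of b] by fastforce
    have "z - (t0 + 1 + rho - t) = - (t0 + 1 + rho - z - t)" by simp
    moreover have "t0 + 1 + rho - t \<in> ringA" using t t0 by simp
    ultimately show ?thesis using t(2) by (metis nrm_minus)
  qed
qed

section \<open>Euclidean division and Bezout in A\<close>

text \<open>Since the covering bound 1/3 is below 1, rounding \<open>x / d\<close> to a near element
  of A leaves a remainder smaller than \<open>d\<close>.\<close>

lemma ringA_division:
  assumes "x \<in> ringA" "d \<in> ringA" "d \<noteq> 0"
  obtains k where "k \<in> ringA" "nrm (x - k * d) < nrm d"
proof -
  obtain k where k: "k \<in> ringA" "nrm (x / d - k) < 1"
    using nearest_ringA[of "x / d"] nrm_kappa nrm_minus[of kappa] by force
  have "x - k * d = (x / d - k) * d" using assms by (simp add: field_simps)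
  then have "nrm (x - k * d) < 1 * nrm d"
    using k assms by (simp only: nrm_mult) (intro mult_strict_right_mono, auto)
  then show ?thesis using that k by simp
qed

text \<open>A nonzero element of least norm in the ideal \<open>I\<close> generated by
  \<open>p\<close> and \<open>q\<close> divides all of \<open>I\<close>, because a nonzero remainder
  would be smaller still.\<close>

lemma ringA_bezout:
  assumes pq: "p \<in> ringA" "q \<in> ringA" "p \<noteq> 0 \<or> q \<noteq> 0"
  obtains \<alpha> \<beta> k l where "\<alpha> \<in> ringA" "\<beta> \<in> ringA" "k \<in> ringA" "l \<in> ringA"
    "\<alpha> * p + \<beta> * q \<noteq> 0" "p = k * (\<alpha> * p + \<beta> * q)" "q = l * (\<alpha> * p + \<beta> * q)"
proof -
  define I where "I = {\<alpha> * p + \<beta> * q | \<alpha> \<beta>. \<alpha> \<in> ringA \<and> \<beta> \<in> ringA}"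
  have sub: "I \<subseteq> ringA" using pq by (auto simp: I_def)
  have pI: "p \<in> I" unfolding I_def
    by (rule CollectI, rule exI[of _ 1], rule exI[of _ 0]) simp
  have qI: "q \<in> I" unfolding I_def
    by (rule CollectI, rule exI[of _ 0], rule exI[of _ 1]) simp
  have step: "x - k * y \<in> I" if xy: "x \<in> I" "y \<in> I" "k \<in> ringA" for x y k
  proof -
    obtain \<alpha> \<beta> \<alpha>' \<beta>' where *: "\<alpha> \<in> ringA" "\<beta> \<in> ringA" "\<alpha>' \<in> ringA" "\<beta>' \<in> ringA"
      "x = \<alpha> * p + \<beta> * q" "y = \<alpha>' * p + \<beta>' * q" using xy unfolding I_def by blast
    then have "x - k * y = (\<alpha> - k * \<alpha>') * p + (\<beta> - k * \<beta>') * q" by (simp add: algebra_simps)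
    then show ?thesis using * xy unfolding I_def by (auto intro!: exI)
  qed
  \<comment> \<open>Indexing norms by natural numbers makes \<open>LEAST\<close> available.\<close>
  define P where "P n \<longleftrightarrow> (\<exists>d\<in>I. d \<noteq> 0 \<and> nrm d = real n)" for n
  have "\<exists>n. P n" using pq pI qI nrm_ringA unfolding P_def by metis
  then have "P (LEAST n. P n)" by (rule LeastI_ex)
  then obtain d where d: "d \<in> I" "d \<noteq> 0" "nrm d = real (LEAST n. P n)"
    unfolding P_def by blast
  have small: "x = 0" if x: "x \<in> I" "nrm x < nrm d" for x
  proof (rule ccontr)
    assume "x \<noteq> 0"
    obtain n where n: "nrm x = real n" using nrm_ringA x sub by blast
    then have "P n" using x \<open>x \<noteq> 0\<close> unfolding P_def by blast
    then have "(LEAST n. P n) \<le> n" by (rule Least_le)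
    then show False using n x d by simp
  qed
  have dvd: "\<exists>k\<in>ringA. x = k * d" if x: "x \<in> I" for x
  proof -
    obtain k where "k \<in> ringA" "nrm (x - k * d) < nrm d"
      using ringA_division x sub d by blast
    then show ?thesis using small step x d by (metis eq_iff_diff_eq_0)
  qed
  obtain \<alpha> \<beta> where "\<alpha> \<in> ringA" "\<beta> \<in> ringA" "d = \<alpha> * p + \<beta> * q" using d by (auto simp: I_def)
  then show ?thesis using that d dvd[OF pI] dvd[OF qI] by blast
qed

section \<open>Hermitian forms in coordinates and base change\<close>

text \<open>With real coefficients, values of a form can serve as diagonal coefficients of the same
  form in another basis.\<close>

definition hf :: "real \<Rightarrow> real \<Rightarrow> complex \<Rightarrow> complex \<Rightarrow> complex \<Rightarrow> real" where
  "hf a c \<nu> x y = a * nrm x + c * nrm y + 2 * Re (\<nu> * x * cnj y)"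

text \<open>The sesquilinear form polarizing \<open>hf\<close>, at the vectors \<open>(p, q)\<close>
  and \<open>(r, s)\<close>: the off-diagonal matrix entry in that basis.\<close>

definition hb :: "real \<Rightarrow> real \<Rightarrow> complex \<Rightarrow> complex \<Rightarrow> complex \<Rightarrow> complex \<Rightarrow> complex \<Rightarrow> complex" where
  "hb a c \<nu> p q r s = of_real a * p * cnj r + of_real c * q * cnj s + \<nu> * p * cnj s + cnj \<nu> * cnj r * q"

text \<open>Over the complex numbers the form is a polynomial in the variables and their conjugates,
  so the identities below reduce to ring arithmetic.\<close>

lemma of_real_hf:
  "complex_of_real (hf a c \<nu> x y)
    = of_real a * x * cnj x + of_real c * y * cnj y + \<nu> * x * cnj y + cnj \<nu> * cnj x * y"
  unfolding hf_def by (simp add: of_real_nrm complex_eq_iff algebra_simps)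

lemma hval_eq_hf: "hval f v = hf (of_rat (coef_a f)) (of_rat (coef_c f)) (coef_nu f) (v $ 1) (v $ 2)"
  by (simp add: hval_def hf_def algebra_simps)

lemma hf_basis_change:
  "hf a c \<nu> (p * x + r * y) (q * x + s * y) =
   hf (hf a c \<nu> p q) (hf a c \<nu> r s) (hb a c \<nu> p q r s) x y"
proof -
  have "complex_of_real (hf a c \<nu> (p * x + r * y) (q * x + s * y)) =
      of_real (hf (hf a c \<nu> p q) (hf a c \<nu> r s) (hb a c \<nu> p q r s) x y)"
    by (simp add: of_real_hf hb_def algebra_simps)
  then show ?thesis by (simp only: of_real_eq_iff)
qed

text \<open>Multiplicativity of the determinant, applied to the congruence by the matrix with
  columns \<open>(p, q)\<close> and \<open>(r, s)\<close>.\<close>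

lemma hf_det_basis_change:
  "hf a c \<nu> p q * hf a c \<nu> r s - nrm (hb a c \<nu> p q r s) = (a * c - nrm \<nu>) * nrm (p * s - q * r)"
proof -
  have "complex_of_real (hf a c \<nu> p q * hf a c \<nu> r s - nrm (hb a c \<nu> p q r s)) =
      of_real ((a * c - nrm \<nu>) * nrm (p * s - q * r))"
    by (simp add: of_real_hf hb_def of_real_nrm algebra_simps)
  then show ?thesis by (simp only: of_real_eq_iff)
qed

lemma hf_scale: "hf a c \<nu> (d * x) (d * y) = nrm d * hf a c \<nu> x y"
proof -
  have "complex_of_real (hf a c \<nu> (d * x) (d * y)) = of_real (nrm d * hf a c \<nu> x y)"
    by (simp add: of_real_hf of_real_nrm algebra_simps)
  then show ?thesis by (simp only: of_real_eq_iff)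
qed

text \<open>Divided by the value at \<open>(p, q)\<close>, the off-diagonal entry can therefore be
  shifted by any element of A.\<close>

lemma hb_shear:
  "hb a c \<nu> p q (r - t * p) (s - t * q) = hb a c \<nu> p q r s - cnj t * of_real (hf a c \<nu> p q)"
  by (simp add: of_real_hf hb_def algebra_simps)

text \<open>Two unit vectors give the diagonal; \<open>(1, 1)\<close> and \<open>(rho, 1)\<close>
  then give \<nu>, as \<open>1\<close> and \<open>rho\<close> are independent over the
  reals.\<close>

lemma hf_coeffs_unique:
  assumes "\<And>x y. x \<in> ringA \<Longrightarrow> y \<in> ringA \<Longrightarrow> hf a c \<nu> x y = hf a' c' \<nu>' x y"
  shows "a = a'" "c = c'" "\<nu> = \<nu>'"
proof -
  show a: "a = a'" using assms[of 1 0] by (simp add: hf_def)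
  show c: "c = c'" using assms[of 0 1] by (simp add: hf_def)
  have "Re \<nu> = Re \<nu>'" using assms[of 1 1] a c by (simp add: hf_def)
  moreover have "Re (\<nu> * rho) = Re (\<nu>' * rho)" using assms[of rho 1] a c by (simp add: hf_def)
  ultimately show "\<nu> = \<nu>'" by (simp add: complex_eq_iff rho_eq)
qed

section \<open>Minimal vectors and reduced bases\<close>

locale integral_definite =
  fixes a c :: real and \<nu> :: complex
  assumes Ints: "\<And>x y. x \<in> ringA \<Longrightarrow> y \<in> ringA \<Longrightarrow> hf a c \<nu> x y \<in> \<int>"
    and pos: "\<And>x y. x \<in> ringA \<Longrightarrow> y \<in> ringA \<Longrightarrow> x \<noteq> 0 \<or> y \<noteq> 0 \<Longrightarrow> hf a c \<nu> x y > 0"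
begin

text \<open>Values at nonzero lattice vectors are positive integers, so a least one is
  attained.\<close>

lemma minimum_exists:
  obtains p q where "p \<in> ringA" "q \<in> ringA" "p \<noteq> 0 \<or> q \<noteq> 0"
    "\<And>x y. x \<in> ringA \<Longrightarrow> y \<in> ringA \<Longrightarrow> x \<noteq> 0 \<or> y \<noteq> 0 \<Longrightarrow> hf a c \<nu> p q \<le> hf a c \<nu> x y"
proof -
  define P where
    "P n \<longleftrightarrow> (\<exists>x\<in>ringA. \<exists>y\<in>ringA. (x \<noteq> 0 \<or> y \<noteq> 0) \<and> hf a c \<nu> x y = real n)" for n
  have val: "\<exists>n. hf a c \<nu> x y = real n" if "x \<in> ringA" "y \<in> ringA" "x \<noteq> 0 \<or> y \<noteq> 0" for x y
    using Ints[of x y] pos[of x y] that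
    by (metis Ints_cases less_imp_le of_int_0_le_iff of_int_of_nat_eq zero_le_imp_eq_int)
  have "\<exists>n. P n" using val[of 1 0] unfolding P_def by (metis ringA_0 ringA_1 zero_neq_one)
  then have "P (LEAST n. P n)" by (rule LeastI_ex)
  then obtain p q where pq: "p \<in> ringA" "q \<in> ringA" "p \<noteq> 0 \<or> q \<noteq> 0"
    "hf a c \<nu> p q = real (LEAST n. P n)" unfolding P_def by blast
  show ?thesis
  proof (rule that[OF pq(1-3)])
    fix x y assume xy: "x \<in> ringA" "y \<in> ringA" "x \<noteq> 0 \<or> y \<noteq> 0"
    then obtain n where n: "hf a c \<nu> x y = real n" using val by blast
    then have "P n" unfolding P_def using xy by blast
    then show "hf a c \<nu> p q \<le> hf a c \<nu> x y" using pq n by (simp add: Least_le)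
  qed
qed

text \<open>Bezout coefficients complete a minimal vector to a basis of determinant 1; the three
  alternatives are those of \<open>nearest_ringA\<close>, scaled by the minimum.\<close>

lemma reduced_basis:
  obtains p q r s where "p \<in> ringA" "q \<in> ringA" "r \<in> ringA" "s \<in> ringA" "p * s - q * r = 1"
    "\<And>x y. x \<in> ringA \<Longrightarrow> y \<in> ringA \<Longrightarrow> x \<noteq> 0 \<or> y \<noteq> 0 \<Longrightarrow> hf a c \<nu> p q \<le> hf a c \<nu> x y"
    "nrm (hb a c \<nu> p q r s) < (hf a c \<nu> p q)\<^sup>2 / 3
      \<or> hb a c \<nu> p q r s = of_real (hf a c \<nu> p q) * kappa
      \<or> hb a c \<nu> p q r s = - of_real (hf a c \<nu> p q) * kappa"
proof -
  obtain p q where pq: "p \<in> ringA" "q \<in> ringA" "p \<noteq> 0 \<or> q \<noteq> 0"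
    and min: "\<And>x y. x \<in> ringA \<Longrightarrow> y \<in> ringA \<Longrightarrow> x \<noteq> 0 \<or> y \<noteq> 0 \<Longrightarrow> hf a c \<nu> p q \<le> hf a c \<nu> x y"
    using minimum_exists by metis
  define m where "m = hf a c \<nu> p q"
  have m: "m > 0" using pos pq by (simp add: m_def)
  obtain \<alpha> \<beta> k l where bez: "\<alpha> \<in> ringA" "\<beta> \<in> ringA" "k \<in> ringA" "l \<in> ringA"
    "\<alpha> * p + \<beta> * q \<noteq> 0" "p = k * (\<alpha> * p + \<beta> * q)" "q = l * (\<alpha> * p + \<beta> * q)"
    by (rule ringA_bezout[OF pq])
  define d where "d = \<alpha> * p + \<beta> * q"
  have d: "d \<in> ringA" "d \<noteq> 0" "p = d * k" "q = d * l"
    using bez pq by (simp_all add: d_def mult.commute)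
  \<comment> \<open>A common divisor \<open>d\<close> of the minimal vector is a unit, as dividing by it scales the value by \<open>1 / nrm d\<close>.\<close>
  have "k \<noteq> 0 \<or> l \<noteq> 0" using d pq by auto
  then have kl: "m \<le> hf a c \<nu> k l" "hf a c \<nu> k l > 0" using min pos bez by (auto simp: m_def)
  have "m = nrm d * hf a c \<nu> k l" unfolding m_def using d hf_scale by simp
  then have "nrm d * hf a c \<nu> k l \<le> 1 * hf a c \<nu> k l" using kl by simp
  then have "nrm d \<le> 1" using kl by (simp only: mult_le_cancel_right)
  moreover obtain n where n: "nrm d = real n" using nrm_ringA d by blast
  moreover have "nrm d > 0" using d by simp
  ultimately have "n = 1" by simp
  then have "complex_of_real (nrm d) = 1" using n by simp
  then have dd: "d * cnj d = 1" by (simp only: of_real_nrm)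
  \<comment> \<open>As \<open>cnj d\<close> is the inverse of \<open>d\<close>, it rescales \<alpha>
    \<open>* p +\<close> \<beta> \<open>* q = d\<close> to determinant 1.\<close>
  define s where "s = \<alpha> * cnj d"
  define r where "r = - \<beta> * cnj d"
  have rs: "r \<in> ringA" "s \<in> ringA" using bez d by (simp_all add: r_def s_def)
  have "p * s - q * r = d * cnj d" unfolding r_def s_def
    by (subst (3) d_def) (simp add: algebra_simps)
  then have det: "p * s - q * r = 1" using dd by simp
  obtain t where t: "t \<in> ringA" and near: "nrm (hb a c \<nu> p q r s / of_real m - t) < 1/3
      \<or> hb a c \<nu> p q r s / of_real m - t = kappa \<or> hb a c \<nu> p q r s / of_real m - t = - kappa"
    using nearest_ringA by blast
  define u where "u = hb a c \<nu> p q r s / of_real m - t"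
  \<comment> \<open>The shear uses \<open>cnj t\<close> because \<open>hb\<close> is
    conjugate-linear in its second vector.\<close>
  have hb: "hb a c \<nu> p q (r - cnj t * p) (s - cnj t * q) = of_real m * u"
    using m unfolding hb_shear u_def m_def[symmetric] by (simp add: field_simps)
  have red: "nrm (of_real m * u) < m\<^sup>2 / 3 \<or> of_real m * u = of_real m * kappa
      \<or> of_real m * u = - of_real m * kappa"
    using near m unfolding u_def[symmetric] by (auto simp: nrm_mult field_simps)
  show ?thesis
  proof (rule that[of p q "r - cnj t * p" "s - cnj t * q"])
    show "p * (s - cnj t * q) - q * (r - cnj t * p) = 1" using det by (simp add: algebra_simps)
  qed (use pq rs t min hb red in \<open>auto simp: m_def\<close>)
qed

text \<open>In a reduced basis the determinant is
  \<open>m * m' - nrm (hb a c \<nu> p q r s)\<close>, with \<open>m \<le> m'\<close> and the norm at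
  most \<open>m\<^sup>2 / 3\<close>. Equality in the bound forces equality in both
  estimates.\<close>

lemma minimum_bound:
  obtains p q r s where "p \<in> ringA" "q \<in> ringA" "r \<in> ringA" "s \<in> ringA" "p * s - q * r = 1"
    "\<And>x y. x \<in> ringA \<Longrightarrow> y \<in> ringA \<Longrightarrow> x \<noteq> 0 \<or> y \<noteq> 0 \<Longrightarrow> hf a c \<nu> p q \<le> hf a c \<nu> x y"
    "2 * (hf a c \<nu> p q)\<^sup>2 \<le> 3 * (a * c - nrm \<nu>)"
    "2 * (hf a c \<nu> p q)\<^sup>2 = 3 * (a * c - nrm \<nu>) \<Longrightarrow> hf a c \<nu> r s = hf a c \<nu> p q \<and>
      (hb a c \<nu> p q r s = of_real (hf a c \<nu> p q) * kappa
      \<or> hb a c \<nu> p q r s = - of_real (hf a c \<nu> p q) * kappa)"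
proof -
  obtain p q r s where b: "p \<in> ringA" "q \<in> ringA" "r \<in> ringA" "s \<in> ringA" "p * s - q * r = 1"
    and min: "\<And>x y. x \<in> ringA \<Longrightarrow> y \<in> ringA \<Longrightarrow> x \<noteq> 0 \<or> y \<noteq> 0 \<Longrightarrow> hf a c \<nu> p q \<le> hf a c \<nu> x y"
    and red: "nrm (hb a c \<nu> p q r s) < (hf a c \<nu> p q)\<^sup>2 / 3
      \<or> hb a c \<nu> p q r s = of_real (hf a c \<nu> p q) * kappa
      \<or> hb a c \<nu> p q r s = - of_real (hf a c \<nu> p q) * kappa"
    using reduced_basis by metis
  define m where "m = hf a c \<nu> p q"
  define m' where "m' = hf a c \<nu> r s"
  have "p \<noteq> 0 \<or> q \<noteq> 0" "r \<noteq> 0 \<or> s \<noteq> 0" using b by auto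
  then have m: "m > 0" "m \<le> m'" using pos min b by (auto simp: m_def m'_def)
  have det: "3 * (a * c - nrm \<nu>) = 3 * (m * m') - 3 * nrm (hb a c \<nu> p q r s)"
    using hf_det_basis_change[of a c \<nu> p q r s] b by (simp add: m_def m'_def)
  have mm: "m\<^sup>2 \<le> m * m'" "m\<^sup>2 = m * m' \<longleftrightarrow> m' = m" using m by (auto simp: power2_eq_square)
  have le: "nrm (hb a c \<nu> p q r s) \<le> m\<^sup>2 / 3"
    using red by (auto simp: nrm_mult nrm_kappa m_def)
  \<comment> \<open>At a deep hole the norm is exactly \<open>m\<^sup>2 / 3\<close>, by
    \<open>nrm_kappa\<close>.\<close>
  have deep: "nrm (hb a c \<nu> p q r s) = m\<^sup>2 / 3"
    if "\<not> nrm (hb a c \<nu> p q r s) < (hf a c \<nu> p q)\<^sup>2 / 3"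
    using red that by (auto simp: nrm_mult nrm_kappa m_def)
  show ?thesis
  proof (rule that[OF b min])
    show "2 * (hf a c \<nu> p q)\<^sup>2 \<le> 3 * (a * c - nrm \<nu>)"
      using le mm(1) unfolding det m_def[symmetric] by linarith
    assume eq: "2 * (hf a c \<nu> p q)\<^sup>2 = 3 * (a * c - nrm \<nu>)"
    then have ns: "\<not> nrm (hb a c \<nu> p q r s) < (hf a c \<nu> p q)\<^sup>2 / 3"
      using mm(1) unfolding det m_def[symmetric] by linarith
    then have "m\<^sup>2 = m * m'" using deep[OF ns] eq unfolding det m_def[symmetric] by linarith
    then show "hf a c \<nu> r s = hf a c \<nu> p q \<and>
      (hb a c \<nu> p q r s = of_real (hf a c \<nu> p q) * kappa
      \<or> hb a c \<nu> p q r s = - of_real (hf a c \<nu> p q) * kappa)"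
      using ns red mm by (simp add: m_def m'_def)
  qed
qed

end

section \<open>From coordinates to forms on A^2\<close>

lemma csqrt_minus_3: "csqrt (- 3) = \<i> * of_real (sqrt 3)"
  using csqrt_of_real_nonpos[of "-3"] by simp

text \<open>Positivity is assumed on \<open>spaceK2\<close>; this inclusion hands it to lattice
  vectors.\<close>

lemma ringA_subset_fieldK: "ringA \<subseteq> fieldK"
proof
  fix z assume "z \<in> ringA"
  then obtain m n where "z = of_int m + of_int n * rho" using ringA_iff by metis
  moreover have "rho = of_rat (1/2) + of_rat (1/2) * csqrt (-3)"
    by (simp add: csqrt_minus_3 rho_eq complex_eq_iff of_rat_divide)
  ultimately have "z = of_int m + of_int n * (of_rat (1/2) + of_rat (1/2) * csqrt (-3))"
    by (simp only:)
  then have "z = of_rat (of_int m + of_int n / 2) + of_rat (of_int n / 2) * csqrt (-3)"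
    by (simp add: of_rat_add of_rat_divide algebra_simps)
  then show "z \<in> fieldK" unfolding fieldK_def by blast
qed

lemma latticeA2_iff: "v \<in> latticeA2 \<longleftrightarrow> v $ 1 \<in> ringA \<and> v $ 2 \<in> ringA"
  by (simp add: latticeA2_def forall_2)

lemma vector2_in_latticeA2: "x \<in> ringA \<Longrightarrow> y \<in> ringA \<Longrightarrow> vector [x, y] \<in> latticeA2"
  by (simp add: latticeA2_iff)

lemma vec2_eq_0_iff: "(v :: complex ^ 2) = 0 \<longleftrightarrow> v $ 1 = 0 \<and> v $ 2 = 0"
  by (simp add: vec_eq_iff forall_2)

lemma pip_form_integral_definite:
  assumes "pip_form f"
  shows "integral_definite (of_rat (coef_a f)) (of_rat (coef_c f)) (coef_nu f)"
proof
  fix x y assume xy: "x \<in> ringA" "y \<in> ringA"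
  define v :: "complex ^ 2" where "v = vector [x, y]"
  have h: "hval f v = hf (of_rat (coef_a f)) (of_rat (coef_c f)) (coef_nu f) x y"
    by (simp add: hval_eq_hf v_def)
  have "v \<in> latticeA2" using xy vector2_in_latticeA2 by (simp add: v_def)
  then show "hf (of_rat (coef_a f)) (of_rat (coef_c f)) (coef_nu f) x y \<in> \<int>"
    using assms h by (auto simp: pip_form_def hform_integral_def)
  assume "x \<noteq> 0 \<or> y \<noteq> 0"
  then have "v \<noteq> 0" by (auto simp: vec2_eq_0_iff v_def)
  moreover have "v \<in> spaceK2"
    using xy ringA_subset_fieldK by (auto simp: spaceK2_def v_def forall_2)
  ultimately show "hf (of_rat (coef_a f)) (of_rat (coef_c f)) (coef_nu f) x y > 0"
    using assms h by (auto simp: pip_form_def hform_pos_def_def)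
qed

section \<open>The extremal form\<close>

text \<open>The equality case with minimum 1. As a quadratic form of rank four over the integers it
  is the root lattice D4 scaled to minimum 1.\<close>

definition kappa_form :: hform where
  "kappa_form = \<lparr>coef_a = 1, coef_c = 1, coef_nu = kappa\<rparr>"

lemma hval_kappa_form: "hval kappa_form v = hf 1 1 kappa (v $ 1) (v $ 2)"
  by (simp add: hval_eq_hf kappa_form_def)

lemma disc_kappa_form: "disc kappa_form = - 2"
  by (simp add: disc_def kappa_form_def nrm_kappa)

text \<open>\<open>kappa\<close> generates the inverse different of A, so the cross term, the trace
  of \<open>kappa\<close> times an element of A, is an integer.\<close>

lemma hf_kappa_Ints:
  assumes "x \<in> ringA" "y \<in> ringA"
  shows "hf 1 1 kappa x y \<in> \<int>"
proof -
  obtain m n where "x * cnj y = of_int m + of_int n * rho"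
    using assms ringA_iff ringA_mult ringA_cnj by metis
  then have "kappa * x * cnj y = kappa * (of_int m + of_int n * rho)" by (simp add: mult.assoc)
  moreover have "2 * Re (kappa * (of_int m + of_int n * rho)) = of_int m"
    by (simp add: kappa_def rho_eq field_simps)
  ultimately have "2 * Re (kappa * x * cnj y) = of_int m" by (simp only:)
  then show ?thesis using assms nrm_ringA_Ints by (simp add: hf_def)
qed

text \<open>Completing the hermitian square leaves \<open>1 - nrm kappa = 2/3\<close> as the
  coefficient of \<open>nrm y\<close>.\<close>

lemma hf_kappa_pos:
  assumes "x \<noteq> 0 \<or> y \<noteq> 0"
  shows "hf 1 1 kappa x y > 0"
proof -
  have "complex_of_real (hf 1 1 kappa x y)
      = of_real (nrm (x + cnj kappa * y) + (1 - nrm kappa) * nrm y)"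
    by (simp add: of_real_hf of_real_nrm algebra_simps)
  then have h: "hf 1 1 kappa x y = nrm (x + cnj kappa * y) + 2/3 * nrm y"
    unfolding of_real_eq_iff by (simp add: nrm_kappa)
  show ?thesis
  proof (cases "y = 0")
    case True
    then show ?thesis using assms h by simp
  next
    case False
    then have "2/3 * nrm y > 0" by simp
    then show ?thesis using h nrm_nonneg[of "x + cnj kappa * y"] by linarith
  qed
qed

lemma pip_kappa_form: "pip_form kappa_form"
  unfolding pip_form_def
proof (intro conjI)
  have "kappa = of_rat (1/2) + of_rat (1/6) * csqrt (-3)"
    by (simp add: csqrt_minus_3 kappa_def rho_eq complex_eq_iff of_rat_divide)
  then show "hermitian_form kappa_form"
    unfolding hermitian_form_def fieldK_def by (auto simp: kappa_form_def)
  show "hform_integral kappa_form"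
    by (auto simp: hform_integral_def hval_kappa_form latticeA2_iff hf_kappa_Ints)
  have "hval kappa_form (vector [1, 0]) = of_int 1" by (simp add: hval_kappa_form hf_def)
  then have "1 \<in> {n :: int. \<exists>w\<in>latticeA2. hval kappa_form w = of_int n}"
    using vector2_in_latticeA2[of 1 0] by auto
  then have "Gcd {n :: int. \<exists>w\<in>latticeA2. hval kappa_form w = of_int n} dvd 1"
    by (rule Gcd_dvd)
  then show "hform_primitive kappa_form" unfolding hform_primitive_def
    by (simp add: zdvd1_eq)
  show "hform_pos_def kappa_form"
    by (auto simp: hform_pos_def_def hval_kappa_form vec2_eq_0_iff hf_kappa_pos)
qed

section \<open>Invariance of the discriminant under GL_2(A)\<close>

lemma GL2A_nrm_det:
  assumes "g \<in> GL2A"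
  shows "nrm (g $ 1 $ 1 * g $ 2 $ 2 - g $ 2 $ 1 * g $ 1 $ 2) = 1"
proof -
  obtain h where h: "\<forall>i j. g $ i $ j \<in> ringA" "\<forall>i j. h $ i $ j \<in> ringA" "g ** h = mat 1"
    using assms by (auto simp: GL2A_def)
  then have "det g * det h = 1" by (metis det_I det_mul)
  moreover have "det g \<in> ringA" "det h \<in> ringA" using h by (simp_all add: det_2)
  ultimately have "nrm (det g) = 1" using ringA_unit_nrm by blast
  then show ?thesis by (simp add: det_2 mult.commute)
qed

lemma matrix_vector_mult_2:
  fixes g :: "complex ^ 2 ^ 2"
  shows "(g *v w) $ 1 = g $ 1 $ 1 * w $ 1 + g $ 1 $ 2 * w $ 2"
    "(g *v w) $ 2 = g $ 2 $ 1 * w $ 1 + g $ 2 $ 2 * w $ 2"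
  by (simp_all add: matrix_vector_mult_def sum_2)

text \<open>Equivalence compares values on the lattice only; these determine the coefficients, so
  those of \<open>f'\<close> come from the base change by the columns of \<open>g\<close>, whose
  determinant has norm 1.\<close>

lemma GL2A_equiv_disc:
  assumes "GL2A_equiv f f'"
  shows "disc f' = disc f"
proof -
  obtain g where g: "g \<in> GL2A" "\<forall>w\<in>latticeA2. hval f' w = hval f (g *v w)"
    using assms by (auto simp: GL2A_equiv_def)
  define a c \<nu> where "a = real_of_rat (coef_a f)" and "c = real_of_rat (coef_c f)" and "\<nu> = coef_nu f"
  define p q r s where "p = g $ 1 $ 1" and "q = g $ 2 $ 1" and "r = g $ 1 $ 2" and "s = g $ 2 $ 2"
  have "hf (of_rat (coef_a f')) (of_rat (coef_c f')) (coef_nu f') x y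
      = hf (hf a c \<nu> p q) (hf a c \<nu> r s) (hb a c \<nu> p q r s) x y"
    if "x \<in> ringA" "y \<in> ringA" for x y
    using g(2)[rule_format, OF vector2_in_latticeA2[OF that]]
    by (simp add: hval_eq_hf matrix_vector_mult_2 p_def q_def r_def s_def a_def c_def \<nu>_def
        flip: hf_basis_change)
  note coeffs = hf_coeffs_unique[OF this]
  have "nrm (p * s - q * r) = 1" using GL2A_nrm_det[OF g(1)] by (simp add: p_def q_def r_def s_def)
  then show ?thesis
    using hf_det_basis_change[of a c \<nu> p q r s]
    by (simp add: disc_def coeffs) (simp add: a_def c_def \<nu>_def)
qed

section \<open>The bound, the equality case and uniqueness of the class\<close>

text \<open>The minimum is named as an integer \<open>m\<close> so that primitivity can be tested by
  divisibility. In the equality case \<open>e\<close> absorbs the sign of the deep hole.\<close>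

lemma pip_form_reduced_basis:
  assumes "pip_form f"
  obtains p q r s m where "p \<in> ringA" "q \<in> ringA" "r \<in> ringA" "s \<in> ringA" "p * s - q * r = 1"
    "m > 0" "is_minimum f (of_int m)" "2 * (of_int m)\<^sup>2 \<le> - disc f"
    "2 * (of_int m)\<^sup>2 = - disc f \<Longrightarrow> \<exists>e\<in>{1, - 1}. \<forall>x y.
       hval f (vector [p * x + r * y, q * x + s * y]) = of_int m * hf 1 1 kappa (e * x) y"
proof -
  define a c \<nu> where "a = real_of_rat (coef_a f)" and "c = real_of_rat (coef_c f)" and "\<nu> = coef_nu f"
  interpret integral_definite a c \<nu>
    using pip_form_integral_definite[OF assms] by (simp add: a_def c_def \<nu>_def)
  obtain p q r s where b: "p \<in> ringA" "q \<in> ringA" "r \<in> ringA" "s \<in> ringA" "p * s - q * r = 1"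
    and min: "\<And>x y. x \<in> ringA \<Longrightarrow> y \<in> ringA \<Longrightarrow> x \<noteq> 0 \<or> y \<noteq> 0 \<Longrightarrow> hf a c \<nu> p q \<le> hf a c \<nu> x y"
    and le: "2 * (hf a c \<nu> p q)\<^sup>2 \<le> 3 * (a * c - nrm \<nu>)"
    and eq: "2 * (hf a c \<nu> p q)\<^sup>2 = 3 * (a * c - nrm \<nu>) \<Longrightarrow> hf a c \<nu> r s = hf a c \<nu> p q \<and>
      (hb a c \<nu> p q r s = of_real (hf a c \<nu> p q) * kappa
      \<or> hb a c \<nu> p q r s = - of_real (hf a c \<nu> p q) * kappa)"
    using minimum_bound by metis
  have pq: "p \<noteq> 0 \<or> q \<noteq> 0" using b by auto
  obtain m where m: "hf a c \<nu> p q = of_int m" using Ints b Ints_cases by metis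
  have "m > 0" using pos[OF b(1,2) pq] m by simp
  have hv: "hval f v = hf a c \<nu> (v $ 1) (v $ 2)" for v
    by (simp add: hval_eq_hf a_def c_def \<nu>_def)
  have D: "- disc f = 3 * (a * c - nrm \<nu>)" by (simp add: disc_def a_def c_def \<nu>_def)
  have "is_minimum f (of_int m)"
    unfolding is_minimum_def
  proof
    show "\<exists>v\<in>latticeA2 - {0}. hval f v = of_int m"
      using b pq m vector2_in_latticeA2[OF b(1,2)]
      by (intro bexI[of _ "vector [p, q]"]) (auto simp: hv vec2_eq_0_iff)
    show "\<forall>v\<in>latticeA2 - {0}. of_int m \<le> hval f v"
      using min by (auto simp: hv vec2_eq_0_iff latticeA2_iff simp flip: m)
  qed
  moreover have "\<exists>e\<in>{1, - 1}. \<forall>x y.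
       hval f (vector [p * x + r * y, q * x + s * y]) = of_int m * hf 1 1 kappa (e * x) y"
    if extremal: "2 * (real_of_int m)\<^sup>2 = - disc f"
  proof -
    have "2 * (hf a c \<nu> p q)\<^sup>2 = 3 * (a * c - nrm \<nu>)" using extremal D m by simp
    note eq = eq[OF this]
    obtain e :: complex where "e \<in> {1, - 1}" "hb a c \<nu> p q r s = of_int m * (e * kappa)"
    proof (cases "hb a c \<nu> p q r s = of_int m * kappa")
      case True
      then show ?thesis using that[of 1] by simp
    next
      case False
      then show ?thesis using that[of "- 1"] eq m by simp
    qed
    moreover have "hf a c \<nu> r s = of_int m" using eq m by simp
    \<comment> \<open>As \<open>nrm e = 1\<close>, replacing \<open>x\<close> by
      \<open>e * x\<close> changes only the cross term.\<close>
    moreover have "hf (of_int m) (of_int m) (of_int m * (e * kappa)) x y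
        = of_int m * hf 1 1 kappa (e * x) y" for x y
      using \<open>e \<in> {1, - 1}\<close> by (auto simp: hf_def algebra_simps)
    ultimately show ?thesis using m by (auto simp: hv hf_basis_change)
  qed
  ultimately show ?thesis using that b \<open>m > 0\<close> le m D by metis
qed

lemma is_minimum_unique: "is_minimum f m \<Longrightarrow> is_minimum f m' \<Longrightarrow> m = m'"
  unfolding is_minimum_def by (metis order_antisym)

text \<open>A positive integer \<open>m\<close> with \<open>2 * m\<^sup>2 \<le> 2\<close> is
  1.\<close>

lemma pip_form_disc_minus_2_imp_minimum:
  assumes "pip_form f" "disc f = - 2"
  shows "is_minimum f (sqrt (- disc f / 2))"
proof -
  obtain m where m: "m > 0" "is_minimum f (of_int m)" "2 * (real_of_int m)\<^sup>2 \<le> - disc f"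
    using pip_form_reduced_basis[OF assms(1)] by metis
  then have "(real_of_int m)\<^sup>2 \<le> 1\<^sup>2" using assms by simp
  then have "real_of_int m \<le> 1" by (rule power2_le_imp_le) simp
  then have "m = 1" using m by linarith
  then show ?thesis using m assms by simp
qed

lemma extremal_pip_form_equiv:
  assumes "pip_form f" "is_minimum f (sqrt (- disc f / 2))"
  shows "GL2A_equiv kappa_form f"
proof -
  obtain p q r s m where b: "p \<in> ringA" "q \<in> ringA" "r \<in> ringA" "s \<in> ringA" "p * s - q * r = 1"
    and m: "m > 0" "is_minimum f (of_int m)" "2 * (real_of_int m)\<^sup>2 \<le> - disc f"
    and eq: "2 * (real_of_int m)\<^sup>2 = - disc f \<Longrightarrow> \<exists>e\<in>{1, - 1}. \<forall>x y.
       hval f (vector [p * x + r * y, q * x + s * y]) = of_int m * hf 1 1 kappa (e * x) y"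
    using pip_form_reduced_basis[OF assms(1)] by metis
  have "real_of_int m = sqrt (- disc f / 2)" using is_minimum_unique m assms by blast
  then have "(real_of_int m)\<^sup>2 = (sqrt (- disc f / 2))\<^sup>2" by simp
  \<comment> \<open>\<open>sqrt\<close> is an odd function on the reals, so squaring recovers its
    argument only if that is nonnegative.\<close>
  moreover have "- disc f / 2 \<ge> 0" using m(3) zero_le_power2[of "real_of_int m"] by linarith
  ultimately have "2 * (real_of_int m)\<^sup>2 = - disc f" by simp
  then obtain e where e: "e = 1 \<or> e = - 1"
    and f: "\<And>x y. hval f (vector [p * x + r * y, q * x + s * y]) = of_int m * hf 1 1 kappa (e * x) y"
    using eq by blast
  have eA: "e \<in> ringA" "e * e = 1" using e by auto
  \<comment> \<open>The inverse of the basis matrix, of determinant 1, gives the coordinates of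
    \<open>w\<close> in the reduced basis.\<close>
  have inv: "hval f w = of_int m * hf 1 1 kappa (e * (s * w $ 1 - r * w $ 2)) (p * w $ 2 - q * w $ 1)" for w
  proof -
    have "p * (s * w $ 1 - r * w $ 2) + r * (p * w $ 2 - q * w $ 1) = (p * s - q * r) * w $ 1"
      "q * (s * w $ 1 - r * w $ 2) + s * (p * w $ 2 - q * w $ 1) = (p * s - q * r) * w $ 2"
      by (simp_all add: algebra_simps)
    then have "vector [p * (s * w $ 1 - r * w $ 2) + r * (p * w $ 2 - q * w $ 1),
      q * (s * w $ 1 - r * w $ 2) + s * (p * w $ 2 - q * w $ 1)] = w"
      using b by (simp add: vec_eq_iff forall_2)
    then show ?thesis using f[of "s * w $ 1 - r * w $ 2" "p * w $ 2 - q * w $ 1"] by simp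
  qed
  \<comment> \<open>\<open>kappa_form\<close> is integral, so \<open>m\<close> divides every value
    of \<open>f\<close>; primitivity then leaves \<open>m = 1\<close>.\<close>
  have "m dvd n" if "w \<in> latticeA2" "hval f w = of_int n" for n w
  proof -
    have "hf 1 1 kappa (e * (s * w $ 1 - r * w $ 2)) (p * w $ 2 - q * w $ 1) \<in> \<int>"
      using that b eA by (intro hf_kappa_Ints) (simp_all add: latticeA2_iff)
    then obtain k where "hf 1 1 kappa (e * (s * w $ 1 - r * w $ 2)) (p * w $ 2 - q * w $ 1) = of_int k"
      by (elim Ints_cases)
    then have "real_of_int n = of_int (m * k)" using inv[of w] that by simp
    then show ?thesis by (simp only: of_int_eq_iff) simp
  qed
  then have "m dvd Gcd {n :: int. \<exists>w\<in>latticeA2. hval f w = of_int n}"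
    by (intro Gcd_greatest) blast
  then have "m dvd 1" using assms(1) by (simp add: pip_form_def hform_primitive_def)
  then have m1: "m = 1" using m by simp
  \<comment> \<open>\<open>h\<close> is the inverse basis matrix with its first row multiplied by
    \<open>e\<close>; \<open>g\<close> is its inverse.\<close>
  define h :: "complex ^ 2 ^ 2" where "h = vector [vector [e * s, - e * r], vector [- q, p]]"
  define g :: "complex ^ 2 ^ 2" where "g = vector [vector [e * p, r], vector [e * q, s]]"
  have entries: "\<forall>i j. h $ i $ j \<in> ringA" "\<forall>i j. g $ i $ j \<in> ringA"
    using b eA by (simp_all add: h_def g_def forall_2)
  have "g ** h = mat 1" "h ** g = mat 1"
    using b(5) e by (auto simp: vec_eq_iff forall_2 matrix_matrix_mult_def sum_2 mat_def g_def h_def algebra_simps)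
  then have "h \<in> GL2A" using entries by (auto simp: GL2A_def)
  moreover have "hval f w = hval kappa_form (h *v w)" for w
    using inv[of w] m1
    by (simp add: hval_kappa_form matrix_vector_mult_2 h_def algebra_simps)
  ultimately show ?thesis by (auto simp: GL2A_equiv_def)
qed

theorem theorem8p4:
  "(\<forall>f. pip_form f \<longrightarrow> (\<exists>v\<in>latticeA2. v \<noteq> 0 \<and> hval f v \<le> sqrt (- disc f / 2))) \<and>
   (\<exists>f0. pip_form f0 \<and> disc f0 = - 2 \<and>
      (\<forall>f. pip_form f \<longrightarrow> (disc f = - 2 \<longleftrightarrow> GL2A_equiv f0 f)) \<and>
      (\<forall>f. pip_form f \<longrightarrow> (is_minimum f (sqrt (- disc f / 2)) \<longleftrightarrow> GL2A_equiv f0 f)))"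
proof (intro conjI allI impI exI[of _ kappa_form])
  fix f assume "pip_form f"
  then obtain m where m: "is_minimum f (of_int m)" "2 * (real_of_int m)\<^sup>2 \<le> - disc f"
    using pip_form_reduced_basis by metis
  then have "real_of_int m \<le> sqrt (- disc f / 2)" by (intro real_le_rsqrt) simp
  then show "\<exists>v\<in>latticeA2. v \<noteq> 0 \<and> hval f v \<le> sqrt (- disc f / 2)"
    using m(1) unfolding is_minimum_def by fastforce
next
  fix f assume f: "pip_form f"
  \<comment> \<open>The three conditions form a cycle: equivalence to \<open>kappa_form\<close>
    gives discriminant -2, which gives the extremal minimum, which gives equivalence.\<close>
  have "GL2A_equiv kappa_form f \<Longrightarrow> disc f = - 2"
    using GL2A_equiv_disc disc_kappa_form by metis
  then show "disc f = - 2 \<longleftrightarrow> GL2A_equiv kappa_form f"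
    "is_minimum f (sqrt (- disc f / 2)) \<longleftrightarrow> GL2A_equiv kappa_form f"
    using f pip_form_disc_minus_2_imp_minimum extremal_pip_form_equiv by blast+
qed (simp_all add: pip_kappa_form disc_kappa_form)

end
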